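(* Any time-like W-surface in $\mathbb R^3_1$ whose invariants $K=\nu_1\nu_2$, $H=\frac12(\nu_1+\nu_2)$, $H'=\frac12(\nu_1-\nu_2)$ satisfy a linear relation $$\delta K=\alpha H+\beta H'+\gamma,\qquad \alpha,\beta,\gamma,\delta\ \text{constants},\quad \alpha^2-\beta^2+4\gamma\delta\neq0,$$ is a linear fractional time-like Weingarten surface, i.e. its principal curvatures satisfy $$\nu_1=\frac{A\nu_2+B}{C\nu_2+D},\qquad BC-AD\neq0,$$ for some constants $A,B,C,D$; and vice versa (every linear fractional time-like Weingarten surface satisfies a linear relation $\delta K=\alpha H+\beta H'+\gamma$ with constants $\alpha,\beta,\gamma,\delta$ such that $\alpha^2-\beta^2+4\gamma\delta\neq0$).
   Context: $\mathbb R^3_1$ is $\mathbb R^3$ with the flat metric $\langle x,y\rangle=x_1y_1+x_2y_2-x_3y_3$. For a time-like surface $z=z(u,v)$ in principal parameters, with unit normal $l$, $\langle l,l\rangle=1$, and coefficients $E=\langle z_u,z_u\rangle<0$, $G=\langle z_v,z_v\rangle>0$, $F=\langle z_u,z_v\rangle=0$, $L=\langle l,z_{uu}\rangle$, $M=\langle l,z_{uv}\rangle=0$, $N=\langle l,z_{vv}\rangle$, the principal curvatures are $\nu_1=L/E$, $\nu_2=N/G$. All surfaces considered have real distinct principal curvatures ($H^2-K>0$). The surface is a Weingarten surface (W-surface) if there are differentiable functions $f(\nu),g(\nu)$ with $f-g\ne0$, $f'g'\neq0$, and a function $\nu=\nu(u,v)$ such that $\nu_1=f(\nu)$, $\nu_2=g(\nu)$.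 The case $A=D$, $B=C=0$ (which means $\nu_1=\nu_2$) is excluded. *)

theory Defs
  imports "HOL-Analysis.Analysis"
begin

definition mink :: "real^3 \<Rightarrow> real^3 \<Rightarrow> real" where
  "mink x y = x$1 * y$1 + x$2 * y$2 - x$3 * y$3"

definition du :: "(real \<times> real \<Rightarrow> 'a::real_normed_vector) \<Rightarrow> real \<times> real \<Rightarrow> 'a" where
  "du z p = vector_derivative (\<lambda>t. z (t, snd p)) (at (fst p))"

definition dv :: "(real \<times> real \<Rightarrow> 'a::real_normed_vector) \<Rightarrow> real \<times> real \<Rightarrow> 'a" where
  "dv z p = vector_derivative (\<lambda>t. z (fst p, t)) (at (snd p))"

text \<open>Class $C^k$ on a set that is open in all uses below.\<close>

primrec Ck_on :: "nat \<Rightarrow> (real \<times> real) set \<Rightarrow> (real \<times> real \<Rightarrow> 'a::real_normed_vector) \<Rightarrow> bool" where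
  "Ck_on 0 U z \<longleftrightarrow> continuous_on U z"
| "Ck_on (Suc k) U z \<longleftrightarrow> z differentiable_on U \<and> Ck_on k U (du z) \<and> Ck_on k U (dv z)"

definition smooth_on :: "(real \<times> real) set \<Rightarrow> (real \<times> real \<Rightarrow> 'a::real_normed_vector) \<Rightarrow> bool" where
  "smooth_on U z \<longleftrightarrow> (\<forall>k. Ck_on k U z)"

definition coeff_E :: "(real \<times> real \<Rightarrow> real^3) \<Rightarrow> real \<times> real \<Rightarrow> real" where
  "coeff_E z p = mink (du z p) (du z p)"

definition coeff_F :: "(real \<times> real \<Rightarrow> real^3) \<Rightarrow> real \<times> real \<Rightarrow> real" where
  "coeff_F z p = mink (du z p) (dv z p)"

definition coeff_G :: "(real \<times> real \<Rightarrow> real^3) \<Rightarrow> real \<times> real \<Rightarrow> real" where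
  "coeff_G z p = mink (dv z p) (dv z p)"

definition coeff_L :: "(real \<times> real \<Rightarrow> real^3) \<Rightarrow> (real \<times> real \<Rightarrow> real^3) \<Rightarrow> real \<times> real \<Rightarrow> real" where
  "coeff_L z l p = mink (l p) (du (du z) p)"

text \<open>\<open>dv (du z)\<close> is $z_{uv}$: differentiate in $u$ first.\<close>

definition coeff_M :: "(real \<times> real \<Rightarrow> real^3) \<Rightarrow> (real \<times> real \<Rightarrow> real^3) \<Rightarrow> real \<times> real \<Rightarrow> real" where
  "coeff_M z l p = mink (l p) (dv (du z) p)"

definition coeff_N :: "(real \<times> real \<Rightarrow> real^3) \<Rightarrow> (real \<times> real \<Rightarrow> real^3) \<Rightarrow> real \<times> real \<Rightarrow> real" where
  "coeff_N z l p = mink (l p) (dv (dv z) p)"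

definition nu1 :: "(real \<times> real \<Rightarrow> real^3) \<Rightarrow> (real \<times> real \<Rightarrow> real^3) \<Rightarrow> real \<times> real \<Rightarrow> real" where
  "nu1 z l p = coeff_L z l p / coeff_E z p"

definition nu2 :: "(real \<times> real \<Rightarrow> real^3) \<Rightarrow> (real \<times> real \<Rightarrow> real^3) \<Rightarrow> real \<times> real \<Rightarrow> real" where
  "nu2 z l p = coeff_N z l p / coeff_G z p"

definition inv_K :: "(real \<times> real \<Rightarrow> real^3) \<Rightarrow> (real \<times> real \<Rightarrow> real^3) \<Rightarrow> real \<times> real \<Rightarrow> real" where
  "inv_K z l p = nu1 z l p * nu2 z l p"

definition inv_H :: "(real \<times> real \<Rightarrow> real^3) \<Rightarrow> (real \<times> real \<Rightarrow> real^3) \<Rightarrow> real \<times> real \<Rightarrow> real" where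
  "inv_H z l p = (nu1 z l p + nu2 z l p) / 2"

definition inv_H' :: "(real \<times> real \<Rightarrow> real^3) \<Rightarrow> (real \<times> real \<Rightarrow> real^3) \<Rightarrow> real \<times> real \<Rightarrow> real" where
  "inv_H' z l p = (nu1 z l p - nu2 z l p) / 2"

text \<open>A time-like surface \<open>z\<close> over a parameter domain \<open>U\<close>, in principal parameters
  ($F = M = 0$), with chosen unit normal field \<open>l\<close> and distinct real principal curvatures.\<close>

definition timelike_surface ::
    "(real \<times> real) set \<Rightarrow> (real \<times> real \<Rightarrow> real^3) \<Rightarrow> (real \<times> real \<Rightarrow> real^3) \<Rightarrow> bool" where
  "timelike_surface U z l \<longleftrightarrow>
     open U \<and> connected U \<and> U \<noteq> {} \<and> smooth_on U z \<and> smooth_on U l \<and>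
     (\<forall>p\<in>U. mink (l p) (l p) = 1 \<and> mink (l p) (du z p) = 0 \<and> mink (l p) (dv z p) = 0 \<and>
        coeff_E z p < 0 \<and> coeff_G z p > 0 \<and> coeff_F z p = 0 \<and> coeff_M z l p = 0 \<and>
        (inv_H z l p)\<^sup>2 - inv_K z l p > 0)"

text \<open>No regularity of \<open>\<nu>\<close> is demanded: \<open>f\<close> has non-vanishing derivative on the interval \<open>I\<close>,
  hence is invertible there, so \<open>\<nu>\<close> is determined by \<open>f\<close> and \<open>nu1\<close> and is differentiable.\<close>

definition timelike_W_surface ::
    "(real \<times> real) set \<Rightarrow> (real \<times> real \<Rightarrow> real^3) \<Rightarrow> (real \<times> real \<Rightarrow> real^3) \<Rightarrow> bool" where
  "timelike_W_surface U z l \<longleftrightarrow> timelike_surface U z l \<and>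
     (\<exists>(I::real set) f g \<nu>. open I \<and> is_interval I \<and>
        (\<forall>t\<in>I. f differentiable (at t) \<and> g differentiable (at t) \<and>
           f t - g t \<noteq> 0 \<and> deriv f t * deriv g t \<noteq> 0) \<and>
        (\<forall>p\<in>U. \<nu> p \<in> I \<and> nu1 z l p = f (\<nu> p) \<and> nu2 z l p = g (\<nu> p)))"

text \<open>The denominator condition is part of the meaning of the relation, since \<open>x / 0 = 0\<close> in HOL.
  The case $A = D$, $B = C = 0$, i.e. $\nu_1 = \nu_2$, is excluded.\<close>

definition linear_fractional_W_surface ::
    "(real \<times> real) set \<Rightarrow> (real \<times> real \<Rightarrow> real^3) \<Rightarrow> (real \<times> real \<Rightarrow> real^3) \<Rightarrow> bool" where
  "linear_fractional_W_surface U z l \<longleftrightarrow> timelike_W_surface U z l \<and>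
     (\<exists>A B C D :: real. B * C - A * D \<noteq> 0 \<and> \<not> (A = D \<and> B = 0 \<and> C = 0) \<and>
        (\<forall>p\<in>U. C * nu2 z l p + D \<noteq> 0 \<and>
           nu1 z l p = (A * nu2 z l p + B) / (C * nu2 z l p + D)))"

end

theory Submission
  imports Defs
begin

text \<open>Multiplied out, both relations are one bilinear equation x (C y + D) = A y + B between x
  = \<nu>1 and y = \<nu>2, with A = (\<alpha> - \<beta>)/2, B = \<gamma>, C = \<delta>, D =
  -(\<alpha> + \<beta>)/2 (\<open>linear_relation_iff_bilinear\<close>). This change of constants is
  invertible and turns \<alpha>^2 - \<beta>^2 + 4 \<gamma> \<delta> into 4 (B C - A D), so the two
  nondegeneracy conditions agree. Nondegeneracy also makes division by C y + D legitimate
  (\<open>bilinear_iff_linear_fractional\<close>). The geometry enters only through \<nu>1 \<noteq>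
  \<nu>2, which rules out the identity map.\<close>

lemma linear_relation_iff_bilinear:
  "\<delta> * inv_K z l p = \<alpha> * inv_H z l p + \<beta> * inv_H' z l p + \<gamma> \<longleftrightarrow>
   nu1 z l p * (\<delta> * nu2 z l p - (\<alpha> + \<beta>) / 2) = (\<alpha> - \<beta>) / 2 * nu2 z l p + \<gamma>"
  unfolding inv_K_def inv_H_def inv_H'_def by (auto simp: field_simps)

text \<open>A zero of the denominator would force the numerator to vanish at the same y, which a
  nonzero determinant forbids. Hence the bilinear equation by itself guarantees that the quotient is
  meaningful.\<close>

lemma bilinear_iff_linear_fractional:
  fixes A B C D x y :: "'a::field"
  assumes "B * C - A * D \<noteq> 0"
  shows "x * (C * y + D) = A * y + B \<longleftrightarrow>
    C * y + D \<noteq> 0 \<and> x = (A * y + B) / (C * y + D)"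
proof -
  have "C * y + D \<noteq> 0" if "x * (C * y + D) = A * y + B"
  proof
    assume "C * y + D = 0"
    \<comment> \<open>This combination eliminates y: it equals the determinant B C - A D.\<close>
    with that have "C * (A * y + B) - A * (C * y + D) = 0" by simp
    with assms show False by (simp add: algebra_simps)
  qed
  then show ?thesis by (metis nonzero_eq_divide_eq)
qed

text \<open>H^2 - K is the square of (\<nu>1 - \<nu>2)/2, so its positivity separates the principal
  curvatures.\<close>

lemma timelike_surface_nu1_neq_nu2:
  assumes "timelike_surface U z l" "p \<in> U"
  shows "nu1 z l p \<noteq> nu2 z l p"
proof
  assume "nu1 z l p = nu2 z l p"
  then have "(inv_H z l p)\<^sup>2 - inv_K z l p = 0"
    by (simp add: inv_H_def inv_K_def power2_eq_square)
  with assms show False unfolding timelike_surface_def by fastforce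
qed

theorem lemma5p1:
  fixes U :: "(real \<times> real) set" and z l :: "real \<times> real \<Rightarrow> real^3"
  shows "(timelike_W_surface U z l \<and>
          (\<exists>\<alpha> \<beta> \<gamma> \<delta> :: real. \<alpha>\<^sup>2 - \<beta>\<^sup>2 + 4 * \<gamma> * \<delta> \<noteq> 0 \<and>
             (\<forall>p\<in>U. \<delta> * inv_K z l p = \<alpha> * inv_H z l p + \<beta> * inv_H' z l p + \<gamma>)))
         \<longleftrightarrow> linear_fractional_W_surface U z l"
    (is "?W \<and> ?lin \<longleftrightarrow> _")
proof
  assume "?W \<and> ?lin"
  then obtain \<alpha> \<beta> \<gamma> \<delta> :: real where W: ?W and ne: "\<alpha>\<^sup>2 - \<beta>\<^sup>2 + 4 * \<gamma> * \<delta> \<noteq> 0"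
    and rel: "\<forall>p\<in>U. \<delta> * inv_K z l p = \<alpha> * inv_H z l p + \<beta> * inv_H' z l p + \<gamma>"
    by blast
  define A D where "A = (\<alpha> - \<beta>) / 2" and "D = - ((\<alpha> + \<beta>) / 2)"
  have "4 * (\<gamma> * \<delta> - A * D) = \<alpha>\<^sup>2 - \<beta>\<^sup>2 + 4 * \<gamma> * \<delta>"
    by (simp add: A_def D_def field_simps power2_eq_square)
  with ne have det: "\<gamma> * \<delta> - A * D \<noteq> 0" by auto
  have "nu1 z l p * (\<delta> * nu2 z l p + D) = A * nu2 z l p + \<gamma>" if "p \<in> U" for p
    using rel that unfolding linear_relation_iff_bilinear
    by (simp add: A_def D_def)
  then have frac: "\<delta> * nu2 z l p + D \<noteq> 0 \<and>
      nu1 z l p = (A * nu2 z l p + \<gamma>) / (\<delta> * nu2 z l p + D)" if "p \<in> U" for p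
    using that by (simp flip: bilinear_iff_linear_fractional [OF det])
  from W have surf: "timelike_surface U z l" by (simp add: timelike_W_surface_def)
  then obtain q where q: "q \<in> U" unfolding timelike_surface_def by blast
  \<comment> \<open>In the excluded case the fraction at \<open>q\<close> reduces to \<nu>2, since D
    \<noteq> 0 there; a single point suffices, and \<open>U\<close> is nonempty.\<close>
  have "\<not> (A = D \<and> \<gamma> = 0 \<and> \<delta> = 0)"
    using frac [OF q] timelike_surface_nu1_neq_nu2 [OF surf q] by auto
  with W det frac show "linear_fractional_W_surface U z l"
    unfolding linear_fractional_W_surface_def by blast
next
  assume "linear_fractional_W_surface U z l"
  then obtain A B C D :: real where W: ?W and det: "B * C - A * D \<noteq> 0"
    and frac: "\<forall>p\<in>U. C * nu2 z l p + D \<noteq> 0 \<and>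
      nu1 z l p = (A * nu2 z l p + B) / (C * nu2 z l p + D)"
    unfolding linear_fractional_W_surface_def by blast
  \<comment> \<open>Obtained by solving A = (\<alpha> - \<beta>)/2 and D = -(\<alpha> + \<beta>)/2;
    B and C serve as \<gamma> and \<delta>.\<close>
  define \<alpha> \<beta> where "\<alpha> = A - D" and "\<beta> = - (A + D)"
  have "\<alpha>\<^sup>2 - \<beta>\<^sup>2 + 4 * B * C = 4 * (B * C - A * D)"
    by (simp add: \<alpha>_def \<beta>_def algebra_simps power2_eq_square)
  with det have "\<alpha>\<^sup>2 - \<beta>\<^sup>2 + 4 * B * C \<noteq> 0" by simp
  moreover have "\<forall>p\<in>U. C * inv_K z l p = \<alpha> * inv_H z l p + \<beta> * inv_H' z l p + B"
    using frac unfolding linear_relation_iff_bilinear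
    by (simp add: \<alpha>_def \<beta>_def flip: bilinear_iff_linear_fractional [OF det])
  ultimately show "?W \<and> ?lin" using W by blast
qed

end
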